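(* Let $f:\mathbb{T}\to[0,1]$ be a Borel function with $\sigma:=\int_{\mathbb{T}} f\,d\mathfrak{m}\in(0,1)$, and let $\mathfrak{X}$ be the determinantal point process on $\mathbb{Z}$ induced by the kernel $K_f(n,m)=\widehat{f}(n-m)$. Then almost surely $\mathfrak{X}_+:=\mathfrak{X}\cap\mathbb{N}$ is not syndetic.
   Context: $\mathbb{T}=\mathbb{R}/\mathbb{Z}$ with normalized Lebesgue measure $\mathfrak{m}$; $\widehat{f}(n)=\int_{\mathbb{T}} f(t)e^{-2\pi i n t}\,d\mathfrak{m}(t)$; $\mathbb{N}$ is the set of non-negative integers. The (stationary) determinantal point process $\mathfrak{X}$ induced by $K_f$ is the random subset $\mathfrak{X}=\mathfrak{X}(\omega)$ of $\mathbb{Z}$, defined on a probability space $(\Omega,\mathcal{A},\mathbb{P})$, whose indicator random variables $\xi_n(\omega)=1$ if $n\in\mathfrak{X}(\omega)$ and $\xi_n(\omega)=0$ otherwise satisfy, for all distinct $n_1,\dots,n_k\in\mathbb{Z}$, $\mathbb{E}(\xi_{n_1}\cdots\xi_{n_k})=\det(\widehat{f}(n_i-n_j))_{1\le i,j\le k}$. Such a process exists and its law is uniquely determined by $f$. An infinite set of non-negative integers, listed increasingly as $(u_n)$, is syndetic if it has bounded gaps, i.e. $\sup_n(u_{n+1}-u_n)<\infty$. *)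

theory Defs
  imports "HOL-Probability.Probability" "Jordan_Normal_Form.Determinant"
begin

text \<open>Functions on the circle \<open>\<real>/\<int>\<close> are represented by 1-periodic functions on \<open>\<real>\<close>;
  normalized Lebesgue measure is Lebesgue measure on the fundamental domain \<open>[0,1)\<close>.\<close>

definition circle_fun :: "(real \<Rightarrow> 'a) \<Rightarrow> bool" where
  "circle_fun f \<longleftrightarrow> (\<forall>t. f (t + 1) = f t)"

definition circle_integral :: "(real \<Rightarrow> 'a::{banach, second_countable_topology}) \<Rightarrow> 'a" where
  "circle_integral f = (LINT t:{0..<1}|lborel. f t)"

definition fourier_coeff :: "(real \<Rightarrow> real) \<Rightarrow> int \<Rightarrow> complex" where
  "fourier_coeff f n =
     circle_integral (\<lambda>t. complex_of_real (f t) * exp (- 2 * of_real pi * \<i> * of_int n * of_real t))"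

definition fourier_kernel :: "(real \<Rightarrow> real) \<Rightarrow> int \<Rightarrow> int \<Rightarrow> complex" where
  "fourier_kernel f n m = fourier_coeff f (n - m)"

definition point_indicator :: "('w \<Rightarrow> int set) \<Rightarrow> int \<Rightarrow> 'w \<Rightarrow> real" where
  "point_indicator X n \<omega> = (if n \<in> X \<omega> then 1 else 0)"

text \<open>The constants \<open>det\<close> and \<open>mat\<close> are those of \<open>Jordan_Normal_Form\<close>, where the matrix
  size is a term, so that it can be quantified over; the distinct points are given as a list.\<close>

definition determinantal_process ::
    "'w measure \<Rightarrow> (int \<Rightarrow> int \<Rightarrow> complex) \<Rightarrow> ('w \<Rightarrow> int set) \<Rightarrow> bool" where
  "determinantal_process M K X \<longleftrightarrow>
     prob_space M \<and>
     (\<forall>n. point_indicator X n \<in> borel_measurable M) \<and>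
     (\<forall>ns. distinct ns \<longrightarrow>
        complex_of_real (\<integral>\<omega>. (\<Prod>i<length ns. point_indicator X (ns ! i) \<omega>) \<partial>M) =
        Determinant.det (Matrix.mat (length ns) (length ns) (\<lambda>(i, j). K (ns ! i) (ns ! j))))"

text \<open>\<open>enumerate U\<close> lists an infinite set \<open>U\<close> increasingly. Finite sets are not syndetic.\<close>

definition syndetic :: "nat set \<Rightarrow> bool" where
  "syndetic U \<longleftrightarrow>
     infinite U \<and> bdd_above (range (\<lambda>n. enumerate U (Suc n) - enumerate U n))"

end

theory Submission imports Defs begin

text \<open>The probability that a finite set \<open>S\<close> contains no point of the process is \<open>det (I - K\<^sub>S)\<close>, and
  \<open>I - K\<close> is the Toeplitz matrix of \<open>1 - f\<close>. For an interval of length \<open>L\<close> this probability \<open>p\<close> does not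
  depend on the position, and it is positive since \<open>1 - f \<ge> 0\<close> does not vanish almost everywhere. For
  two intervals far apart the off-diagonal blocks tend to zero by Bessel's inequality, so that the
  events are asymptotically independent. A second moment estimate then gives infinitely many empty
  intervals of length \<open>L\<close> almost surely, for every \<open>L\<close>.\<close>

section \<open>Mixed moments of points and gaps as determinants\<close>

text \<open>Each factor \<open>1 - \<xi>\<close> splits the expectation as a difference of two expectations; on the other
  side the row \<open>e\<^sub>k - K\<^sub>k\<close> is expanded, and \<open>e\<^sub>k\<close> contributes the minor without the point \<open>k\<close>.\<close>

lemma gap_moment:
  assumes D: "determinantal_process M K X" and "finite B" and "distinct ns"
  shows "complex_of_real (\<integral>\<omega>. (\<Prod>n\<in>set ns. if n \<in> B then 1 - point_indicator X n \<omega>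
            else point_indicator X n \<omega>) \<partial>M) =
         Determinant.det (Matrix.mat (length ns) (length ns) (\<lambda>(i, j).
           if ns ! i \<in> B then (if i = j then 1 else 0) - K (ns ! i) (ns ! j) else K (ns ! i) (ns ! j)))"
  using \<open>finite B\<close> \<open>distinct ns\<close>
\<comment> \<open>The list stays general because the step uses the hypothesis twice: for
  \<open>ns\<close> and for \<open>ns\<close> with the point \<open>b\<close> deleted.\<close>
proof (induction B arbitrary: ns rule: finite_induct)
  case empty
  have "(\<Prod>n\<in>set ns. point_indicator X n \<omega>) = (\<Prod>i<length ns. point_indicator X (ns ! i) \<omega>)" for \<omega>
    using prod.reindex_bij_betw[OF bij_betw_nth[OF empty refl refl], of "\<lambda>n. point_indicator X n \<omega>"]
    by simp
  with D empty show ?case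
    by (simp add: determinantal_process_def)
next
  case (insert b B)
  interpret prob_space M using D by (simp add: determinantal_process_def)
  have meas[measurable]: "point_indicator X n \<in> borel_measurable M" for n
    using D by (simp add: determinantal_process_def)
  define E where "E = (\<lambda>B n \<omega>. if n \<in> B then 1 - point_indicator X n \<omega> else point_indicator X n \<omega>)"
  define A where "A = (\<lambda>B ns. Matrix.mat (length ns) (length ns) (\<lambda>(i, j).
    if ns ! i \<in> B then (if i = j then 1 else 0) - K (ns ! i) (ns ! j) else K (ns ! i) (ns ! j)))"
  have E_meas[measurable]: "E B n \<in> borel_measurable M" for B n
    unfolding E_def by measurable
  have E_int: "integrable M (\<lambda>\<omega>. \<Prod>n\<in>S. E B n \<omega>)" for S B
    by (rule integrable_const_bound[of _ 1])
      (auto simp: E_def point_indicator_def abs_prod intro!: prod_le_1 AE_I2)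
  have IH: "complex_of_real (\<integral>\<omega>. (\<Prod>n\<in>set ns. E B n \<omega>) \<partial>M) = Determinant.det (A B ns)"
    if "distinct ns" for ns
    using insert.IH[OF that] by (simp add: E_def A_def)
  show ?case
  proof (cases "b \<in> set ns")
    case False
    have 1: "(\<Prod>n\<in>set ns. E (insert b B) n \<omega>) = (\<Prod>n\<in>set ns. E B n \<omega>)" for \<omega>
      using False by (intro prod.cong) (auto simp: E_def)
    have 2: "A (insert b B) ns = A B ns"
      using False unfolding A_def by (intro cong_mat) auto
    show ?thesis
      using IH[OF insert.prems] 1 2 by (simp add: E_def A_def)
  next
    case True
    then obtain k where k: "k < length ns" "ns ! k = b"
      by (auto simp: in_set_conv_nth)
    \<comment> \<open>Deleting entry \<open>k\<close> of the list matches deleting row and column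
      \<open>k\<close> of the matrix, so \<open>A B ns'\<close> is a principal minor.\<close>
    define ns' where "ns' = take k ns @ drop (Suc k) ns"
    have len: "length ns' = length ns - 1"
      using k by (simp add: ns'_def)
    have ns: "ns = take k ns @ b # drop (Suc k) ns"
      using k by (metis id_take_nth_drop)
    have "distinct (take k ns @ b # drop (Suc k) ns)"
      using insert.prems ns by metis
    then have dist: "distinct ns'" and "b \<notin> set ns'"
      by (auto simp: ns'_def)
    moreover have "set ns = set (take k ns @ b # drop (Suc k) ns)"
      using ns by metis
    ultimately have set: "set ns = insert b (set ns')" "b \<notin> set ns'"
      by (auto simp: ns'_def)
    have nth: "ns' ! i = ns ! (if i < k then i else Suc i)" if "i < length ns'" for i
      using that k by (auto simp: ns'_def nth_append)
    have eq: "ns ! i = b \<longleftrightarrow> i = k" if "i < length ns" for i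
      using that k insert.prems nth_eq_iff_index_eq by blast
    have "(\<Prod>n\<in>set ns. E (insert b B) n \<omega>) = (\<Prod>n\<in>set ns'. E B n \<omega>) - (\<Prod>n\<in>set ns. E B n \<omega>)" for \<omega>
    proof -
      have "(\<Prod>n\<in>set ns'. E (insert b B) n \<omega>) = (\<Prod>n\<in>set ns'. E B n \<omega>)"
        using set by (intro prod.cong) (auto simp: E_def)
      moreover have "E (insert b B) b \<omega> = 1 - E B b \<omega>"
        using insert.hyps by (simp add: E_def)
      ultimately show ?thesis
        using set by (simp add: left_diff_distrib)
    qed
    then have "complex_of_real (\<integral>\<omega>. (\<Prod>n\<in>set ns. E (insert b B) n \<omega>) \<partial>M) =
        Determinant.det (A B ns') - Determinant.det (A B ns)"
      using IH[OF dist] IH[OF insert.prems] by (simp add: E_int)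
    moreover have "Determinant.det (A (insert b B) ns) = Determinant.det (A B ns') - Determinant.det (A B ns)"
    proof -
      have carr: "A C ns \<in> carrier_mat (length ns) (length ns)" for C
        by (simp add: A_def)
      \<comment> \<open>The matrices for \<open>insert b B\<close> and \<open>B\<close> differ only
        in row \<open>k\<close>, so their cofactors along that row agree.\<close>
      have del: "mat_delete (A (insert b B) ns) k j = mat_delete (A B ns) k j" for j
        unfolding mat_delete_def A_def using eq k by (intro cong_mat) auto
      have "mat_delete (A (insert b B) ns) k k = A B ns'"
        unfolding del unfolding mat_delete_def A_def using eq k len nth
        by (intro cong_mat) (auto simp: nth)
      then have cof: "cofactor (A (insert b B) ns) k k = Determinant.det (A B ns')"
        by (simp add: cofactor_def flip: power2_eq_square mult_2)
      \<comment> \<open>Row \<open>k\<close> changes from \<open>K\<close> to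
        \<open>e\<^sub>k - K\<close> because \<open>b\<close> is not in \<open>B\<close>; expanding
        along it splits the determinant in two.\<close>
      have "A (insert b B) ns $$ (k, j) = (if j = k then 1 else 0) - A B ns $$ (k, j)"
        if "j < length ns" for j
        using that k insert.hyps by (auto simp: A_def)
      then have "Determinant.det (A (insert b B) ns) =
          (\<Sum>j<length ns. (if j = k then cofactor (A (insert b B) ns) k j else 0) -
             A B ns $$ (k, j) * cofactor (A B ns) k j)"
        by (subst laplace_expansion_row[OF carr k(1)])
           (intro sum.cong, auto simp: cofactor_def del left_diff_distrib)
      also have "\<dots> = Determinant.det (A B ns') - Determinant.det (A B ns)"
        using k by (simp add: sum_subtractf cof laplace_expansion_row[OF carr k(1), of B])
      finally show ?thesis .
    qed
    ultimately show ?thesis by (simp add: E_def A_def)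
  qed
qed

section \<open>A second moment criterion for infinitely many occurrences\<close>

context prob_space
begin

text \<open>Chebyshev's argument: if no event from index \<open>k\<close> on occurs, a count of
  \<open>N\<close> of them deviates from its mean \<open>N * p\<close> by the whole mean. Along a
  sparse subsequence the variance is at most \<open>N\<^sup>2 * \<epsilon> + N\<close>, which makes
  such a deviation improbable.\<close>

lemma infinitely_many_of_second_moment:
  fixes A :: "nat \<Rightarrow> 'a set"
  assumes A: "\<And>j. A j \<in> events" and p: "\<And>j. prob (A j) = p" "p > 0"
    and q: "\<And>i j. i < j \<Longrightarrow> prob (A i \<inter> A j) = q (j - i)" "q \<longlonglongrightarrow> p\<^sup>2"
  shows "AE \<omega> in M. \<exists>\<^sub>\<infinity>j. \<omega> \<in> A j"
proof -
  have "AE \<omega> in M. \<exists>j\<ge>k. \<omega> \<in> A j" for k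
  proof -
    define B where "B = {\<omega>\<in>space M. \<forall>j\<ge>k. \<omega> \<notin> A j}"
    have B[measurable]: "B \<in> events"
      using A unfolding B_def by measurable
    have bound: "p\<^sup>2 * prob B \<le> \<epsilon>" if "\<epsilon> > 0" for \<epsilon>
    proof -
      from q(2) \<open>\<epsilon> > 0\<close> obtain D where D: "\<And>d. d \<ge> D \<Longrightarrow> q d \<le> p\<^sup>2 + \<epsilon>"
        by (metis (no_types, lifting) LIMSEQ_D abs_diff_le_iff less_eq_real_def real_norm_def)
      \<comment> \<open>The successor makes the spacing positive, so that the chosen indices are
        distinct, and still at least \<open>D\<close>.\<close>
      define D' where "D' = Suc D"
      define G where "G = (\<lambda>i. A (k + D' * i))"
      have G[measurable]: "G i \<in> events" for i
        using A by (simp add: G_def)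
      \<comment> \<open>On the diagonal the trivial bound 1 suffices: it affects only
        \<open>N\<close> of the \<open>N\<^sup>2\<close> pairs.\<close>
      have GG: "prob (G i \<inter> G j) \<le> p\<^sup>2 + \<epsilon> + (if i = j then 1 else 0)" for i j
      proof -
        have *: "prob (G i \<inter> G j) \<le> p\<^sup>2 + \<epsilon>" if "i < j" for i j
        proof -
          from that have "k + D' * i < k + D' * j"
            using mult_less_mono2[of i j D'] by (simp add: D'_def)
          then have "prob (G i \<inter> G j) = q (D' * j - D' * i)"
            unfolding G_def by (subst q(1)) auto
          moreover have "D' * 1 \<le> D' * (j - i)"
            using that by (intro mult_le_mono) auto
          then have "D' * j - D' * i \<ge> D"
            by (simp add: diff_mult_distrib2 D'_def)
          ultimately show ?thesis using D by simp
        qed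
        show ?thesis
          using *[of i j] *[of j i] that
          by (cases i j rule: linorder_cases) (auto simp: Int_commute intro: order_trans[OF prob_le_1])
      qed
      \<comment> \<open>On \<open>B\<close> none of the events \<open>G i\<close> occurs, so \<open>(S - Np)\<^sup>2 = (Np)\<^sup>2\<close> there.\<close>
      have main: "real N * (p\<^sup>2 * prob B) \<le> real N * \<epsilon> + 1" if "N > 0" for N
      proof -
        define S where "S = (\<lambda>\<omega>. \<Sum>i<N. indicator (G i) \<omega> :: real)"
        have int: "integrable M (\<lambda>\<omega>. indicator (G i) \<omega> :: real)"
             "integrable M (\<lambda>\<omega>. indicator (G i) \<omega> * indicator (G j) \<omega> :: real)" for i j
          by (auto simp: emeasure_eq_measure intro!: integrable_real_indicator simp flip: indicator_inter_arith)
        have S2: "(S \<omega>)\<^sup>2 = (\<Sum>i<N. \<Sum>j<N. indicator (G i) \<omega> * indicator (G j) \<omega>)" for \<omega>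
          by (simp add: S_def power2_eq_square sum_product)
        have intS: "integrable M S" "integrable M (\<lambda>\<omega>. (S \<omega>)\<^sup>2)"
          unfolding S2 unfolding S_def by (intro Bochner_Integration.integrable_sum int)+
        have ES: "expectation S = N * p"
          using p(1) unfolding S_def by (subst Bochner_Integration.integral_sum) (use int in \<open>auto simp: G_def sets.Int_space_eq2[OF A]\<close>)
        have "expectation (\<lambda>\<omega>. (S \<omega>)\<^sup>2) = (\<Sum>i<N. \<Sum>j<N. prob (G i \<inter> G j))"
          using int(2) unfolding S2 indicator_inter_arith[symmetric] by simp
        also have "\<dots> \<le> (\<Sum>i<N. \<Sum>j<N. p\<^sup>2 + \<epsilon> + (if i = j then 1 else 0))"
          by (intro sum_mono GG)
        also have "\<dots> = N\<^sup>2 * (p\<^sup>2 + \<epsilon>) + N"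
          by (simp add: sum.distrib power2_eq_square algebra_simps)
        finally have ES2: "expectation (\<lambda>\<omega>. (S \<omega>)\<^sup>2) \<le> N\<^sup>2 * (p\<^sup>2 + \<epsilon>) + N" .
        have "(N * p)\<^sup>2 * prob B = expectation (\<lambda>\<omega>. (N * p)\<^sup>2 * indicator B \<omega>)"
          by simp
        also have "\<dots> \<le> expectation (\<lambda>\<omega>. (S \<omega>)\<^sup>2 - 2 * (N * p) * S \<omega> + (N * p)\<^sup>2)"
        proof (rule integral_mono)
          fix \<omega> assume "\<omega> \<in> space M"
          have *: "(S \<omega>)\<^sup>2 - 2 * (N * p) * S \<omega> + (N * p)\<^sup>2 = (S \<omega> - N * p)\<^sup>2"
            by (simp add: power2_eq_square algebra_simps)
          have "S \<omega> = 0" if "\<omega> \<in> B"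
            using that by (simp add: S_def B_def G_def)
          then show "(N * p)\<^sup>2 * indicator B \<omega> \<le> (S \<omega>)\<^sup>2 - 2 * (N * p) * S \<omega> + (N * p)\<^sup>2"
            unfolding * by (auto simp: indicator_def)
        qed (use intS in \<open>auto simp: emeasure_eq_measure intro!: integrable_real_indicator\<close>)
        \<comment> \<open>As \<open>S\<close> has mean \<open>N * p\<close>, this is its
          variance.\<close>
        also have "\<dots> = expectation (\<lambda>\<omega>. (S \<omega>)\<^sup>2) - (N * p)\<^sup>2"
          using intS by (simp add: ES prob_space power2_eq_square)
        also have "\<dots> \<le> N * (N * \<epsilon> + 1)"
          using ES2 by (simp add: power2_eq_square algebra_simps)
        finally have "N * (N * (p\<^sup>2 * prob B)) \<le> N * (N * \<epsilon> + 1)"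
          by (simp add: power2_eq_square algebra_simps)
        then show ?thesis using \<open>N > 0\<close> by simp
      qed
      \<comment> \<open>Dividing \<open>main\<close> by \<open>N\<close> and letting
        \<open>N\<close> grow removes the diagonal contribution.\<close>
      have "(\<lambda>N. \<epsilon> + 1 / real N) \<longlonglongrightarrow> \<epsilon> + 0"
        by (intro tendsto_intros lim_1_over_n)
      moreover have "eventually (\<lambda>N. p\<^sup>2 * prob B \<le> \<epsilon> + 1 / real N) sequentially"
        using eventually_gt_at_top[of 0] by eventually_elim (use main in \<open>simp add: field_simps\<close>)
      ultimately show ?thesis
        using tendsto_lowerbound[of "\<lambda>N. \<epsilon> + 1 / real N" \<epsilon> sequentially] by simp
    qed
    have "p\<^sup>2 * prob B \<le> 0"
      by (rule field_le_epsilon) (use bound in auto)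
    then have "prob B = 0"
      using p(2) measure_nonneg[of M B] by (simp add: mult_le_0_iff)
    then have "AE \<omega> in M. \<omega> \<notin> B"
      using B by (intro AE_not_in) (simp add: null_sets_def emeasure_eq_measure)
    with AE_space show ?thesis
      by eventually_elim (auto simp: B_def)
  qed
  then have "AE \<omega> in M. \<forall>k. \<exists>j\<ge>k. \<omega> \<in> A j"
    by (simp add: AE_all_countable)
  then show ?thesis
    by (simp add: INFM_nat_le)
qed

end

section \<open>Long empty windows against bounded gaps\<close>

text \<open>Steps of size at most \<open>C\<close> cannot jump over an empty window of length
  \<open>C + 1\<close>, so an enumeration that starts below the window would stay below it
  forever.\<close>

lemma not_syndetic_of_empty_windows:
  assumes "\<And>L. L > 0 \<Longrightarrow> \<exists>\<^sub>\<infinity>j. {j * L..<j * L + L} \<inter> U = {}"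
  shows "\<not> syndetic U"
proof
  assume "syndetic U"
  then obtain C where inf: "infinite U" and C: "\<And>n. enumerate U (Suc n) - enumerate U n \<le> C"
    by (auto simp: syndetic_def bdd_above_def)
  \<comment> \<open>Since \<open>Suc C \<ge> 1\<close>, the bound on \<open>j\<close> places the
    start \<open>j * Suc C\<close> of the window beyond the first element of
    \<open>U\<close>.\<close>
  from assms[of "Suc C"] obtain j where j: "j > enumerate U 0" "{j * Suc C..<j * Suc C + Suc C} \<inter> U = {}"
    unfolding INFM_nat by blast
  have gt: "enumerate U 0 < j * Suc C"
    using j(1) by (simp add: trans_less_add1)
  have "enumerate U n < j * Suc C" for n
  proof (induction n)
    case (Suc n)
    then have "enumerate U (Suc n) < j * Suc C + Suc C"
      using C[of n] by linarith
    with j(2) enumerate_in_set[OF inf, of "Suc n"] show ?case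
      by (metis atLeastLessThan_iff disjoint_iff not_le)
  qed (rule gt)
  from this[of "j * Suc C"] show False
    using le_enumerate[OF inf, of "j * Suc C"] by simp
qed

section \<open>Measure and characters on the circle\<close>

text \<open>As a probability measure on the fundamental domain it makes bounded measurable functions
  integrable and turns \<open>circle_integral\<close> into an expectation.\<close>

definition circle_measure :: "real measure" where
  "circle_measure = restrict_space lborel {0..<1}"

lemma space_circle_measure[simp]: "space circle_measure = {0..<1}"
  by (simp add: circle_measure_def space_restrict_space)

interpretation circle: prob_space circle_measure
  by (rule prob_spaceI) (simp add: circle_measure_def space_restrict_space emeasure_restrict_space)

lemma borel_measurable_circle[measurable (raw)]:
  "f \<in> borel_measurable borel \<Longrightarrow> f \<in> borel_measurable circle_measure"
  unfolding circle_measure_def by (rule measurable_restrict_space1) simp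

lemma borel_measurable_cis[measurable]: "cis \<in> borel_measurable borel"
  by (intro borel_measurable_continuous_onI continuous_intros)

lemma circle_integral_eq: "circle_integral f = integral\<^sup>L circle_measure f"
  unfolding circle_integral_def circle_measure_def set_lebesgue_integral_def
  by (subst integral_restrict_space) auto

text \<open>Orthogonality of characters: for \<open>n \<noteq> 0\<close> the antiderivative
  \<open>F\<close> takes equal values at 0 and 1.\<close>

lemma circle_integral_cis:
  "(LINT t|circle_measure. cis (2 * pi * of_int n * t)) = (if n = 0 then 1 else 0)"
proof (cases "n = 0")
  case True
  then show ?thesis by (simp add: circle.prob_space[simplified])
next
  case False
  define F where "F = (\<lambda>t::real. cis (2 * pi * of_int n * t) / (2 * pi * of_int n * \<i>))"
  have der: "(F has_vector_derivative cis (2 * pi * of_int n * t)) (at t within {0..1})" for t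
  proof -
    have "((\<lambda>z. exp (\<i> * (2 * pi * of_int n * z)) / (2 * pi * of_int n * \<i>)) has_field_derivative
       exp (\<i> * (2 * pi * of_int n * of_real t))) (at (of_real t))"
      by (rule derivative_eq_intros refl | use False in simp)+
    from has_vector_derivative_real_field[OF this] show ?thesis
      by (simp add: F_def cis_conv_exp)
  qed
  have "(\<integral>t. indicator {0..1} t *\<^sub>R cis (2 * pi * of_int n * t) \<partial>lborel) = F 1 - F 0"
    by (rule integral_FTC_Icc) (auto intro!: der continuous_intros)
  also have "\<dots> = 0"
    using cis_multiple_2pi[of "of_int n"] by (simp add: F_def)
  finally have "(\<integral>t. indicator {0..1} t *\<^sub>R cis (2 * pi * of_int n * t) \<partial>lborel) = 0" .
  moreover have "(\<integral>t. indicator {0..1} t *\<^sub>R cis (2 * pi * of_int n * t) \<partial>lborel) =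
      (\<integral>t. indicator {0..<1} t *\<^sub>R cis (2 * pi * of_int n * t) \<partial>lborel)"
    \<comment> \<open>The fundamental theorem of calculus is applied on the closed interval; the
      extra point 1 is a null set.\<close>
    by (rule integral_cong_AE)
       (use AE_lborel_singleton[of 1] in \<open>auto elim!: eventually_mono simp: indicator_def\<close>)
  ultimately show ?thesis
    using False by (simp flip: circle_integral_eq add: circle_integral_def set_lebesgue_integral_def)
qed

lemma fourier_coeff_cis:
  "fourier_coeff f n = (LINT t|circle_measure. complex_of_real (f t) * cis (2 * pi * of_int (- n) * t))"
  by (simp add: fourier_coeff_def circle_integral_eq cis_conv_exp algebra_simps)

lemma fourier_coeff_uminus: "fourier_coeff f (- n) = cnj (fourier_coeff f n)"
  unfolding fourier_coeff_cis
  \<comment> \<open>Conjugation is its own inverse, so it passes through the integral also when the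
    integral is 0 by default for a non-integrable function.\<close>
  by (subst integral_bounded_linear'[OF bounded_linear_cnj bounded_linear_cnj, symmetric]) (simp_all add: cis_cnj)

text \<open>The polynomial has finitely many roots, and \<open>t \<mapsto> cis (2 * pi * t)\<close>
  is injective on the fundamental domain, so the exceptional set is finite.\<close>

lemma AE_circle_poly_nonzero:
  fixes q :: "complex poly"
  assumes "q \<noteq> 0"
  shows "AE t in circle_measure. poly q (cis (2 * pi * t)) \<noteq> 0"
proof -
  have "inj_on (\<lambda>t. cis (2 * pi * t)) {0..<1}"
  proof (rule inj_onI)
    fix s t :: real assume st: "s \<in> {0..<1}" "t \<in> {0..<1}" "cis (2 * pi * s) = cis (2 * pi * t)"
    then have "cis (2 * pi * (s - t)) = 1"
      by (simp add: right_diff_distrib flip: cis_divide)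
    then obtain k :: int where "2 * pi * (s - t) = 2 * pi * k"
      by (auto simp: complex_eq_iff cos_one_2pi_int mult_ac)
    then have k: "s - t = k" by simp
    with st(1,2) have "\<bar>real_of_int k\<bar> < 1"
      by (auto simp flip: k)
    then have "k = 0" by linarith
    with k show "s = t" by simp
  qed
  then have "finite ((\<lambda>t. cis (2 * pi * t)) -` {z. poly q z = 0} \<inter> {0..<1})"
    by (intro finite_vimage_IntI poly_roots_finite assms)
  then have "AE t in lborel. t \<notin> (\<lambda>t. cis (2 * pi * t)) -` {z. poly q z = 0} \<inter> {0..<1}"
    by (intro AE_not_in finite_imp_null_set_lborel)
  then show ?thesis
    unfolding circle_measure_def by (subst AE_restrict_space_iff) (auto elim!: eventually_mono)
qed

section \<open>Fourier coefficients and Toeplitz matrices of a function with values in the unit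
  interval\<close>

context
  fixes g :: "real \<Rightarrow> real"
  assumes g_borel[measurable]: "g \<in> borel_measurable borel" and g_bound: "\<And>t. g t \<in> {0..1}"
begin

lemma abs_le_1: "\<bar>g t\<bar> \<le> 1"
  using g_bound[of t] by simp

lemma integrable_circle_fun: "integrable circle_measure g"
  by (rule circle.integrable_const_bound[of _ 1]) (use abs_le_1 in auto)

lemma integrable_mult_cis:
  "integrable circle_measure (\<lambda>t. complex_of_real (g t) * cis (a * t))"
  by (rule circle.integrable_const_bound[of _ 1]) (use abs_le_1 in \<open>auto simp: norm_mult\<close>)

lemma fourier_coeff_one_minus:
  "fourier_coeff (\<lambda>t. 1 - g t) n = (if n = 0 then 1 else 0) - fourier_coeff g n"
proof -
  have "integrable circle_measure (\<lambda>t. cis (2 * pi * of_int (- n) * t))"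
    by (rule circle.integrable_const_bound[of _ 1]) auto
  then show ?thesis
    using circle_integral_cis[of "-n"] integrable_mult_cis[of "2 * pi * of_int (- n)"]
    by (simp add: fourier_coeff_cis left_diff_distrib)
qed

text \<open>The mean square distance from \<open>g\<close> to the Fourier sum \<open>P\<close> over
  the frequencies below \<open>N\<close> is non-negative, and the mean square of \<open>g\<close> is
  at most 1.\<close>

lemma bessel: "(\<Sum>n<N. (cmod (fourier_coeff g (int n)))\<^sup>2) \<le> 1"
proof -
  define c where "c = (\<lambda>n::nat. fourier_coeff g (int n))"
  define e where "e = (\<lambda>(n::int) t. cis (2 * pi * of_int n * t))"
  define P where "P = (\<lambda>t. \<Sum>n<N. c n * e (int n) t)"
  have [measurable]: "e n \<in> borel_measurable borel" for n
    unfolding e_def by measurable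
  have int1: "integrable circle_measure (\<lambda>t. complex_of_real ((g t)\<^sup>2))"
    by (rule circle.integrable_const_bound[of _ 1])
       (use abs_le_1 in \<open>auto simp: norm_power abs_square_le_1\<close>)
  have int2: "integrable circle_measure (\<lambda>t. complex_of_real (g t) * e n t)" for n
    unfolding e_def by (rule integrable_mult_cis)
  have int3: "integrable circle_measure (e n)" for n
    by (rule circle.integrable_const_bound[of _ 1]) (auto simp: e_def)
  have e_neg: "cnj (e n t) = e (- n) t" and e_add: "e n t * e m t = e (n + m) t" for n m t
    by (auto simp: e_def cis_cnj cis_mult algebra_simps)
  have exp_e: "circle.expectation (e n) = (if n = 0 then 1 else 0)" for n
    unfolding e_def by (rule circle_integral_cis)
  have exp_g: "circle.expectation (\<lambda>t. complex_of_real (g t) * e (- int n) t) = c n"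
    "circle.expectation (\<lambda>t. complex_of_real (g t) * e (int n) t) = cnj (c n)" for n
    using fourier_coeff_uminus[of g "int n"] by (simp_all add: c_def e_def fourier_coeff_cis)
  have cmod_sq: "complex_of_real ((cmod (g t - P t))\<^sup>2) = complex_of_real ((g t)\<^sup>2)
      - (\<Sum>n<N. cnj (c n) * (complex_of_real (g t) * e (- int n) t))
      - (\<Sum>n<N. c n * (complex_of_real (g t) * e (int n) t))
      + (\<Sum>n<N. \<Sum>m<N. c n * cnj (c m) * e (int n - int m) t)" for t
  proof -
    have "complex_of_real ((cmod (g t - P t))\<^sup>2) = (g t - P t) * (g t - cnj (P t))"
      by (subst complex_norm_square) simp
    also have "\<dots> = complex_of_real ((g t)\<^sup>2) - g t * cnj (P t) - g t * P t + P t * cnj (P t)"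
      by (simp add: algebra_simps power2_eq_square)
    also have "g t * cnj (P t) = (\<Sum>n<N. cnj (c n) * (complex_of_real (g t) * e (- int n) t))"
      by (simp add: P_def e_neg sum_distrib_left mult_ac)
    also have "g t * P t = (\<Sum>n<N. c n * (complex_of_real (g t) * e (int n) t))"
      by (simp add: P_def sum_distrib_left mult_ac)
    also have "P t * cnj (P t) = (\<Sum>n<N. \<Sum>m<N. c n * cnj (c m) * (e (int n) t * e (- int m) t))"
      by (simp add: P_def e_neg sum_product mult_ac)
    finally show ?thesis by (simp add: e_add)
  qed
  have "complex_of_real (circle.expectation (\<lambda>t. (cmod (g t - P t))\<^sup>2)) =
      circle.expectation (\<lambda>t. complex_of_real ((cmod (g t - P t))\<^sup>2))"
    by (simp del: of_real_power)
  \<comment> \<open>By orthogonality only the diagonal of the double sum survives; it cancels one of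
    the two cross terms.\<close>
  also have "\<dots> = complex_of_real (circle.expectation (\<lambda>t. (g t)\<^sup>2))
      - (\<Sum>n<N. cnj (c n) * c n) - (\<Sum>n<N. c n * cnj (c n)) + (\<Sum>n<N. c n * cnj (c n))"
    unfolding cmod_sq using int1
    by (simp add: int2 int3 exp_e exp_g if_distrib del: of_real_power cong: if_cong)
  also have "\<dots> = complex_of_real (circle.expectation (\<lambda>t. (g t)\<^sup>2) - (\<Sum>n<N. (cmod (c n))\<^sup>2))"
    by (simp add: complex_norm_square[symmetric] mult.commute[of "cnj _"] flip: of_real_power)
  finally have "circle.expectation (\<lambda>t. (cmod (g t - P t))\<^sup>2) =
      circle.expectation (\<lambda>t. (g t)\<^sup>2) - (\<Sum>n<N. (cmod (c n))\<^sup>2)"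
    by (simp only: of_real_eq_iff)
  moreover have "0 \<le> circle.expectation (\<lambda>t. (cmod (g t - P t))\<^sup>2)"
    by simp
  moreover have "circle.expectation (\<lambda>t. (g t)\<^sup>2) \<le> 1"
    using abs_le_1 by (intro circle.integral_le_const) (auto simp: abs_square_le_1
        intro!: circle.integrable_const_bound[of _ 1])
  ultimately show ?thesis by (simp add: c_def)
qed

text \<open>The Riemann-Lebesgue lemma, as terms of a convergent series tend to zero; negative
  frequencies follow by conjugation.\<close>

lemma fourier_coeff_tendsto_0:
  "(\<lambda>n. fourier_coeff g (int n)) \<longlonglongrightarrow> 0" "(\<lambda>n. fourier_coeff g (- int n)) \<longlonglongrightarrow> 0"
proof -
  have "summable (\<lambda>n. (cmod (fourier_coeff g (int n)))\<^sup>2)"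
    using bessel by (intro summableI_nonneg_bounded[of _ 1]) auto
  then have "(\<lambda>n. sqrt ((cmod (fourier_coeff g (int n)))\<^sup>2)) \<longlonglongrightarrow> sqrt 0"
    by (intro tendsto_real_sqrt summable_LIMSEQ_zero)
  then show 1: "(\<lambda>n. fourier_coeff g (int n)) \<longlonglongrightarrow> 0"
    by (simp add: tendsto_norm_zero_iff)
  then show "(\<lambda>n. fourier_coeff g (- int n)) \<longlonglongrightarrow> 0"
    using tendsto_cnj[OF 1] by (simp add: fourier_coeff_uminus)
qed

text \<open>A vector \<open>v\<close> in the kernel satisfies \<open>\<integral> g |P|\<^sup>2 = 0\<close> for the trigonometric polynomial \<open>P\<close> with
  coefficients \<open>v\<close>, and \<open>P\<close> has only finitely many zeros.\<close>

lemma toeplitz_nonsingular: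
  assumes "circle_integral g \<noteq> 0"
  shows "Determinant.det (Matrix.mat L L (\<lambda>(i, j). fourier_coeff g (int i - int j))) \<noteq> 0"
proof
  let ?T = "Matrix.mat L L (\<lambda>(i, j). fourier_coeff g (int i - int j))"
  assume "Determinant.det ?T = 0"
  then obtain v where v: "v \<in> carrier_vec L" "v \<noteq> 0\<^sub>v L" "?T *\<^sub>v v = 0\<^sub>v L"
    by (subst (asm) det_0_iff_vec_prod_zero[of _ L]) auto
  define w where "w = (\<lambda>j. vec_index v j)"
  have row: "(\<Sum>j<L. fourier_coeff g (int i - int j) * w j) = 0" if "i < L" for i
  proof -
    have "vec_index (?T *\<^sub>v v) i = 0"
      using that v(3) by simp
    then show ?thesis
      using that v(1) by (simp add: scalar_prod_def w_def atLeast0LessThan)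
  qed
  define e where "e = (\<lambda>(n::int) t. cis (2 * pi * of_int n * t))"
  define P where "P = (\<lambda>t. \<Sum>j<L. w j * e (int j) t)"
  \<comment> \<open>\<open>P t\<close> is the value of \<open>q\<close> at
    \<open>cis (2 * pi * t)\<close>, so roots of polynomials control the zeros of
    \<open>P\<close>.\<close>
  define q where "q = (\<Sum>j<L. monom (w j) j)"
  have e_neg: "cnj (e n t) = e (- n) t" and e_add: "e n t * e m t = e (n + m) t" for n m t
    by (auto simp: e_def cis_cnj cis_mult algebra_simps)
  have [measurable]: "e n \<in> borel_measurable borel" for n
    unfolding e_def by measurable
  have int: "integrable circle_measure (\<lambda>t. complex_of_real (g t) * e n t)" for n
    unfolding e_def by (rule integrable_mult_cis)
  have poly_q: "poly q (cis (2 * pi * t)) = P t" for t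
  proof -
    have "cis (2 * pi * t) ^ j = e (int j) t" for j
      by (simp add: e_def Complex.DeMoivre mult_ac)
    then show ?thesis
      by (simp add: q_def P_def poly_sum poly_monom)
  qed
  have "q \<noteq> 0"
  proof -
    obtain j where "j < L" "w j \<noteq> 0"
      using v(1,2) by (metis carrier_vecD eq_vecI index_zero_vec w_def)
    moreover have "coeff q j = w j" if "j < L" for j
      using that by (simp add: q_def coeff_sum)
    ultimately show ?thesis by (metis coeff_0)
  qed
  then have P0: "AE t in circle_measure. P t \<noteq> 0"
    using AE_circle_poly_nonzero[of q] by (simp add: poly_q)
  \<comment> \<open>After integration this is the quadratic form of \<open>?T\<close> at
    \<open>v\<close>: the inner sum becomes row \<open>i\<close> of \<open>?T *\<^sub>v v\<close>,
    which is 0.\<close>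
  have PP: "complex_of_real (g t * (cmod (P t))\<^sup>2) =
      (\<Sum>i<L. cnj (w i) * (\<Sum>j<L. w j * (complex_of_real (g t) * e (int j - int i) t)))" for t
  proof -
    have "complex_of_real (g t * (cmod (P t))\<^sup>2) = g t * (cnj (P t) * P t)"
      by (simp add: complex_norm_square mult.commute flip: of_real_power)
    also have "\<dots> = (\<Sum>i<L. \<Sum>j<L. cnj (w i) * w j * (complex_of_real (g t) * (e (int j) t * e (- int i) t)))"
      by (simp add: P_def e_neg sum_product sum_distrib_left mult_ac)
    finally show ?thesis
      by (simp add: e_add sum_distrib_left mult_ac)
  qed
  have "complex_of_real (circle.expectation (\<lambda>t. g t * (cmod (P t))\<^sup>2)) =
      circle.expectation (\<lambda>t. complex_of_real (g t * (cmod (P t))\<^sup>2))"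
    by (simp only: integral_complex_of_real)
  also have "\<dots> = (\<Sum>i<L. cnj (w i) * (\<Sum>j<L. w j * fourier_coeff g (int i - int j)))"
    unfolding PP by (simp add: int) (simp add: e_def fourier_coeff_cis)
  also have "\<dots> = 0"
    using row by (simp add: mult.commute)
  finally have "circle.expectation (\<lambda>t. g t * (cmod (P t))\<^sup>2) = 0"
    by (simp only: of_real_eq_0_iff)
  moreover have "integrable circle_measure (\<lambda>t. g t * (cmod (P t))\<^sup>2)"
  proof -
    have "integrable circle_measure (\<lambda>t. complex_of_real (g t * (cmod (P t))\<^sup>2))"
      unfolding PP by (intro Bochner_Integration.integrable_sum integrable_mult_right int)
    then show ?thesis by (subst (asm) complex_of_real_integrable_eq)
  qed
  ultimately have "AE t in circle_measure. g t * (cmod (P t))\<^sup>2 = 0"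
    using g_bound by (subst (asm) integral_nonneg_eq_0_iff_AE) auto
  with P0 have "AE t in circle_measure. g t = 0"
    by eventually_elim auto
  then have "circle_integral g = 0"
    unfolding circle_integral_eq by (rule integral_eq_zero_AE)
  with assms show False ..
qed

end

section \<open>Limits of determinants, windows and gap probabilities\<close>

text \<open>By the Leibniz formula the determinant is a polynomial in the entries.\<close>

lemma det_tendsto:
  fixes A :: "nat \<Rightarrow> complex mat"
  assumes "\<And>k. A k \<in> carrier_mat n n" "B \<in> carrier_mat n n"
    and "\<And>i j. i < n \<Longrightarrow> j < n \<Longrightarrow> (\<lambda>k. A k $$ (i, j)) \<longlonglongrightarrow> B $$ (i, j)"
  shows "(\<lambda>k. Determinant.det (A k)) \<longlonglongrightarrow> Determinant.det B"
proof -
  have "(\<lambda>k. \<Prod>i = 0..<n. A k $$ (i, p i)) \<longlonglongrightarrow> (\<Prod>i = 0..<n. B $$ (i, p i))"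
    if "p permutes {0..<n}" for p
    using permutes_in_image[OF that] by (intro tendsto_prod assms(3)) auto
  then show ?thesis
    unfolding det_def'[OF assms(1)] det_def'[OF assms(2)]
    by (intro tendsto_sum tendsto_mult tendsto_const) auto
qed

text \<open>Blocks aligned at multiples of \<open>L\<close> are pairwise disjoint, and the offset
  between two of them is \<open>L\<close> times the difference of their indices. They are lists
  because \<open>determinantal_process\<close> takes its points in that form.\<close>

definition window :: "nat \<Rightarrow> nat \<Rightarrow> int list" where
  "window L j = map int [j * L..<j * L + L]"

lemma distinct_window: "distinct (window L j)"
  by (simp add: window_def distinct_map)

lemma length_window: "length (window L j) = L"
  by (simp add: window_def)

lemma nth_window: "i < L \<Longrightarrow> window L j ! i = int (j * L + i)"
  by (simp add: window_def)

lemma set_window: "set (window L j) = int ` {j * L..<j * L + L}"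
  by (simp add: window_def)

lemma disjoint_windows: "i < j \<Longrightarrow> set (window L i) \<inter> set (window L j) = {}"
  using mult_le_mono1[of "Suc i" j L] by (auto simp: set_window)

text \<open>The case of \<open>gap_moment\<close> in which \<open>B\<close> contains all the points:
  the product of the factors \<open>1 - \<xi>\<close> is the indicator of the gap event.\<close>

lemma gap_probability:
  assumes D: "determinantal_process M K X" and "distinct ns"
  shows "{\<omega> \<in> space M. set ns \<inter> X \<omega> = {}} \<in> sets M"
    and "complex_of_real (measure M {\<omega> \<in> space M. set ns \<inter> X \<omega> = {}}) =
      Determinant.det (Matrix.mat (length ns) (length ns)
        (\<lambda>(i, j). (if i = j then 1 else 0) - K (ns ! i) (ns ! j)))"
proof -
  interpret prob_space M using D by (simp add: determinantal_process_def)
  let ?E = "{\<omega> \<in> space M. set ns \<inter> X \<omega> = {}}"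
  have [measurable]: "point_indicator X n \<in> borel_measurable M" for n
    using D by (simp add: determinantal_process_def)
  have "?E = {\<omega> \<in> space M. \<forall>n\<in>set ns. point_indicator X n \<omega> = 0}"
    by (auto simp: point_indicator_def split: if_splits)
  also have "\<dots> \<in> sets M" by measurable
  finally show E: "?E \<in> sets M" .
  have "(\<Prod>n\<in>set ns. if n \<in> set ns then 1 - point_indicator X n \<omega> else point_indicator X n \<omega>) =
      indicator ?E \<omega>" if "\<omega> \<in> space M" for \<omega>
    using that by (auto simp: point_indicator_def indicator_def intro!: prod.neutral prod_zero)
  then have "(\<integral>\<omega>. (\<Prod>n\<in>set ns. if n \<in> set ns then 1 - point_indicator X n \<omega>
      else point_indicator X n \<omega>) \<partial>M) = measure M ?E"
    using E by (subst Bochner_Integration.integral_cong[OF refl]) (auto simp: Int_absorb2 sets.sets_into_space)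
  then show "complex_of_real (measure M ?E) = Determinant.det (Matrix.mat (length ns) (length ns)
        (\<lambda>(i, j). (if i = j then 1 else 0) - K (ns ! i) (ns ! j)))"
    using gap_moment[OF D finite_set \<open>distinct ns\<close>, of ns]
    by (auto intro!: arg_cong[of _ _ Determinant.det] cong_mat)
qed

section \<open>Empty windows of every length occur infinitely often\<close>

theorem theorem2p3:
  fixes f :: "real \<Rightarrow> real" and M :: "'w measure" and X :: "'w \<Rightarrow> int set"
  assumes "circle_fun f"
    and "f \<in> borel_measurable borel"
    and "\<And>t. f t \<in> {0..1}"
    and "circle_integral f \<in> {0<..<1}"
    and "determinantal_process M (fourier_kernel f) X"
  shows "AE \<omega> in M. \<not> syndetic {n::nat. int n \<in> X \<omega>}"
proof -
  note D = assms(5)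
  interpret prob_space M using D by (simp add: determinantal_process_def)
  define g where "g = (\<lambda>t. 1 - f t)"
  have g: "g \<in> borel_measurable borel" "\<And>t. g t \<in> {0..1}"
    using assms(2,3) by (auto simp: g_def)
  have g_coeff: "fourier_coeff g n = (if n = 0 then 1 else 0) - fourier_coeff f n" for n
    unfolding g_def by (rule fourier_coeff_one_minus[OF assms(2,3)])
  have g_int: "circle_integral g \<noteq> 0"
    using assms(4) integrable_circle_fun[OF assms(2,3)]
    by (simp add: g_def circle_integral_eq circle.prob_space[simplified])
  define T where "T = (\<lambda>ns ms. Matrix.mat (length ns) (length ms)
    (\<lambda>(i, j). fourier_coeff g (ns ! i - ms ! j)))"
  have gap: "{\<omega> \<in> space M. set ns \<inter> X \<omega> = {}} \<in> events"
      "complex_of_real (prob {\<omega> \<in> space M. set ns \<inter> X \<omega> = {}}) = Determinant.det (T ns ns)"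
    if "distinct ns" for ns
  proof -
    show "{\<omega> \<in> space M. set ns \<inter> X \<omega> = {}} \<in> events"
      by (rule gap_probability[OF D that])
    have "T ns ns = Matrix.mat (length ns) (length ns)
        (\<lambda>(i, j). (if i = j then 1 else 0) - fourier_kernel f (ns ! i) (ns ! j))"
      \<comment> \<open>Distinctness of \<open>ns\<close> turns the condition
        \<open>ns ! i - ns ! j = 0\<close> from \<open>g_coeff\<close> into
        \<open>i = j\<close>.\<close>
      unfolding T_def using that
      by (intro cong_mat) (auto simp: g_coeff fourier_kernel_def nth_eq_iff_index_eq)
    then show "complex_of_real (prob {\<omega> \<in> space M. set ns \<inter> X \<omega> = {}}) = Determinant.det (T ns ns)"
      using gap_probability(2)[OF D that] by simp
  qed
  have "AE \<omega> in M. \<exists>\<^sub>\<infinity>j. {j * L..<j * L + L} \<inter> {n. int n \<in> X \<omega>} = {}" if "L > 0" for L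
  proof -
    define A where "A = (\<lambda>j. {\<omega> \<in> space M. set (window L j) \<inter> X \<omega> = {}})"
    define R where "R = T (window L 0) (window L 0)"
    define S where "S = (\<lambda>d. T (window L 0 @ window L d) (window L 0 @ window L d))"
    \<comment> \<open>The determinants are complex; their equality with probabilities shows
      afterwards that taking the real part loses nothing.\<close>
    define p where "p = Re (Determinant.det R)"
    define q where "q = (\<lambda>d. Re (Determinant.det (S d)))"
    have R_eq: "R = Matrix.mat L L (\<lambda>(i, j). fourier_coeff g (int i - int j))"
      unfolding R_def T_def by (intro cong_mat) (auto simp: length_window nth_window)
    have A_events: "A j \<in> events" for j
      unfolding A_def by (rule gap(1)[OF distinct_window])
    have prob_A: "complex_of_real (prob (A j)) = Determinant.det R" for j
    proof -
      have "T (window L j) (window L j) = R"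
        unfolding R_eq T_def by (intro cong_mat) (auto simp: length_window nth_window)
      then show ?thesis
        using gap(2)[OF distinct_window, of L j] by (simp add: A_def)
    qed
    have p: "prob (A j) = p" for j
      using arg_cong[OF prob_A, of Re] by (simp add: p_def)
    have det_R: "Determinant.det R = complex_of_real p"
      using prob_A p by simp
    have "p \<ge> 0"
      using p[of 0] measure_nonneg[of M "A 0"] by simp
    moreover have "p \<noteq> 0"
      using toeplitz_nonsingular[OF g g_int, of L] det_R by (auto simp: R_eq)
    ultimately have "p > 0" by simp
    have q: "prob (A i \<inter> A j) = q (j - i)" if "i < j" for i j
    proof -
      define d where "d = j - i"
      then have d: "j = i + d" using that by simp
      have "A i \<inter> A j = {\<omega> \<in> space M. set (window L i @ window L j) \<inter> X \<omega> = {}}"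
        by (auto simp: A_def)
      \<comment> \<open>Stationarity: the entries depend only on differences of points, so both
        windows may be shifted by \<open>i * L\<close>.\<close>
      moreover have "T (window L i @ window L j) (window L i @ window L j) = S d"
        unfolding S_def T_def d
        by (intro cong_mat) (auto simp: length_window nth_append nth_window algebra_simps)
      moreover have "distinct (window L i @ window L j)"
        using disjoint_windows[OF that] by (simp add: distinct_window)
      ultimately have "complex_of_real (prob (A i \<inter> A j)) = Determinant.det (S d)"
        using gap(2)[of "window L i @ window L j"] by simp
      from arg_cong[OF this, of Re] show ?thesis
        by (simp add: q_def d)
    qed
    \<comment> \<open>Asymptotic independence: as the windows separate, the matrix becomes block
      diagonal with two copies of \<open>R\<close>.\<close>
    have "(\<lambda>d. Determinant.det (S d)) \<longlonglongrightarrow> Determinant.det (four_block_mat R (0\<^sub>m L L) (0\<^sub>m L L) R)"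
    proof (rule det_tendsto[of _ "L + L"])
      fix i j assume ij: "i < L + L" "j < L + L"
      have lim: "(\<lambda>d. fourier_coeff g (int (d * L) + k)) \<longlonglongrightarrow> 0"
           "(\<lambda>d. fourier_coeff g (k - int (d * L))) \<longlonglongrightarrow> 0" for k :: int
      proof -
        have *: "filterlim (\<lambda>d. nat (int (d * L) + k)) at_top sequentially" for k
          unfolding filterlim_at_top eventually_sequentially
        proof (intro allI exI impI)
          fix Z d assume "d \<ge> nat (int Z - k)"
          moreover have "d \<le> d * L" using \<open>L > 0\<close> by simp
          ultimately show "Z \<le> nat (int (d * L) + k)" by linarith
        qed
        \<comment> \<open>The decay is known along natural numbers; \<open>nat\<close> can be
          removed once its argument is non-negative.\<close>
        have ev: "eventually (\<lambda>d. int (d * L) + k \<ge> 0) sequentially" for k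
          using filterlim_at_top[THEN iffD1, OF *[of k], rule_format, of 1]
          by eventually_elim linarith
        show "(\<lambda>d. fourier_coeff g (int (d * L) + k)) \<longlonglongrightarrow> 0"
          by (rule Lim_transform_eventually[OF filterlim_compose[OF fourier_coeff_tendsto_0(1)[OF g] *[of k]]])
             (use ev[of k] in eventually_elim, simp)
        show "(\<lambda>d. fourier_coeff g (k - int (d * L))) \<longlonglongrightarrow> 0"
          by (rule Lim_transform_eventually[OF filterlim_compose[OF fourier_coeff_tendsto_0(2)[OF g] *[of "-k"]]])
             (use ev[of "-k"] in eventually_elim, simp)
      qed
      \<comment> \<open>\<open>lim(1)\<close> serves the lower left block and \<open>lim(2)\<close>
        the upper right one. In the diagonal blocks \<open>d * L\<close> cancels and the sequence is
        constant.\<close>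
      show "(\<lambda>d. S d $$ (i, j)) \<longlonglongrightarrow> four_block_mat R (0\<^sub>m L L) (0\<^sub>m L L) R $$ (i, j)"
        using ij lim(1)[of "int (i - L) - int j"] lim(2)[of "int i - int (j - L)"]
        by (auto simp: S_def T_def R_eq length_window nth_append nth_window algebra_simps)
    qed (auto simp: S_def T_def R_eq length_window)
    also have "Determinant.det (four_block_mat R (0\<^sub>m L L) (0\<^sub>m L L) R) = complex_of_real (p\<^sup>2)"
      by (subst det_four_block_mat_lower_left_zero[of _ L _ L])
         (auto simp: R_eq det_R[unfolded R_eq] power2_eq_square)
    finally have "q \<longlonglongrightarrow> p\<^sup>2"
      unfolding q_def using tendsto_Re by fastforce
    with A_events p \<open>p > 0\<close> q have "AE \<omega> in M. \<exists>\<^sub>\<infinity>j. \<omega> \<in> A j"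
      by (rule infinitely_many_of_second_moment)
    then show ?thesis
      by eventually_elim (auto simp: A_def set_window elim!: INFM_mono)
  qed
  \<comment> \<open>There are only countably many lengths, so one null set serves all of
    them.\<close>
  then have "AE \<omega> in M. \<forall>L. L > 0 \<longrightarrow> (\<exists>\<^sub>\<infinity>j. {j * L..<j * L + L} \<inter> {n. int n \<in> X \<omega>} = {})"
    by (subst AE_all_countable) auto
  then show ?thesis
    by eventually_elim (rule not_syndetic_of_empty_windows, simp)
qed

end
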